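(* Let $(R,\mathfrak m)$ be a Noetherian local ring of dimension $d\ge1$ and let $\mathcal I^{(1)},\dots,\mathcal I^{(s)}$ be Noetherian graded filtrations of proper ideals of $R$ with $\operatorname{ht}I^{(j)}_1>0$ for every $j$. Choose a common standard Veronese index $q\ge1$, i.e. $I^{(j)}_{qv}=(I^{(j)}_q)^v$ for all $v\ge0$ and all $j$, put $J_j=I^{(j)}_q$, and choose $a\ge1$ such that $I^{(j)}_{qm+r}=J_j^{\,m-a}K_{j,r}$ with $K_{j,r}:=I^{(j)}_{qa+r}$, for all $1\le j\le s$, $0\le r<q$ and $m\ge a$ (such $q$ and $a$ exist). Assume that for every $0\le r<q$, every $1\le i\le d$ and every $\boldsymbol\alpha\in\mathbb N^s$ with $|\boldsymbol\alpha|=i-1$, $$c^\Delta_{i,\boldsymbol\alpha}(J_1^mK_{1,r}|\cdots|J_s^mK_{s,r};R)=m^i\,c^\Delta_{i,\boldsymbol\alpha}(J_1|\cdots|J_s;R)+O(m^{i-1})\qquad(m\to\infty).$$ Then for every $1\le i\le d$ and $|\boldsymbol\alpha|=i-1$, the limit $c^\Delta_{i,\boldsymbol\alpha}(\mathcal I^{(1)}|\cdots|\mathcal I^{(s)};R)=\lim_{n\to\infty}c^\Delta_{i,\boldsymbol\alpha}(I^{(1)}_n|\cdots|I^{(s)}_n;R)/n^i$ exists and is finite, and $$c^\Delta_{i,\boldsymbol\alpha}(\mathcal I^{(1)}|\cdots|\mathcal I^{(s)};R)=\frac{c^\Delta_{i,\boldsymbol\alpha}(I^{(1)}_q|\cd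ots|I^{(s)}_q;R)}{q^i}.$$
   Context: Graded filtration of proper ideals: a sequence $\mathcal I=\{I_n\}_{n\ge0}$ of ideals of $R$ with $I_0=R$, $I_mI_n\subseteq I_{m+n}$ for all $m,n\ge 0$, $I_n\subsetneq R$ for $n\ge1$, and $I_{n+1}\subseteq I_n$ for $n\ge1$. It is Noetherian if $\bigoplus_{n\ge0}I_nt^n\subseteq R[t]$ is a finitely generated $R$-algebra. Diagonal mixed components: for proper ideals $J_1,\dots,J_s$ of $R$ write $J^{\mathbf u}=J_1^{u_1}\cdots J_s^{u_s}$ for $\mathbf u\in\mathbb N^s$, and $\mathbf 1=(1,\dots,1)$. The function $H^\Delta_{\mathbf J}(r,\mathbf u)=\lambda_R\bigl(J^{\mathbf u}/(\mathfrak m^{r+1}J^{\mathbf u}+J^{\mathbf u+\mathbf 1})\bigr)$ ($\lambda_R$ = length) agrees for all large $(r,\mathbf u)$ with a polynomial of total degree at most $d-1$, whose homogeneous part of degree $d-1$ is written $\sum_{i=1}^d\sum_{|\boldsymbol\alpha|=i-1}\frac{c^\Delta_{i,\boldsymbol\alpha}(J_1|\cdots|J_s;R)}{(d-i)!\,\boldsymbol\alpha!}r^{d-i}\mathbf u^{\boldsymbol\alpha}$, where $|\boldsymbol\alpha|=\sum_j\alpha_j$, $\boldsymbol\alpha!=\prod_j\alpha_j!$. This defines $c^\Delta_{i,\boldsymbol\alpha}(J_1|\cdots|J_s;R)$. *)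

theory Defs
  imports
    Complex_Main
    "HOL-Library.Extended_Real"
    "HOL-Library.Landau_Symbols"
    "HOL-Algebra.Ideal_Product"
    "HOL-Algebra.Ring_Divisibility"
    "HOL-Algebra.Generated_Rings"
    "HOL-Algebra.UnivPoly"
begin

locale noetherian_local_ring = noetherian_ring R + cring R for R (structure) +
  assumes ex1_maximalideal: "\<exists>!M. maximalideal M R"

definition max_ideal :: "('a, 'b) ring_scheme \<Rightarrow> 'a set" where
  "max_ideal R = (THE M. maximalideal M R)"

definition prime_chain :: "('a, 'b) ring_scheme \<Rightarrow> nat \<Rightarrow> (nat \<Rightarrow> 'a set) \<Rightarrow> bool" where
  "prime_chain R n P \<longleftrightarrow>
     (\<forall>k\<le>n. primeideal (P k) R) \<and> (\<forall>k<n. P k \<subset> P (Suc k))"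

definition krull_dim :: "('a, 'b) ring_scheme \<Rightarrow> enat" where
  "krull_dim R = Sup {enat n | n. \<exists>P. prime_chain R n P}"

definition prime_height :: "('a, 'b) ring_scheme \<Rightarrow> 'a set \<Rightarrow> enat" where
  "prime_height R Q = Sup {enat n | n. \<exists>P. prime_chain R n P \<and> P n = Q}"

definition ideal_height :: "('a, 'b) ring_scheme \<Rightarrow> 'a set \<Rightarrow> enat" where
  "ideal_height R I = Inf {prime_height R Q | Q. primeideal Q R \<and> I \<subseteq> Q}"


definition module_length :: "('r, 'x) ring_scheme \<Rightarrow> ('r, 'm, 'y) module_scheme \<Rightarrow> enat" where
  "module_length R M =
     Sup {enat n | n. \<exists>C. (\<forall>k\<le>n. submodule (C k) R M) \<and> (\<forall>k<n. C k \<subset> C (Suc k))}"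

text \<open>The \<open>R\<close>-module \<open>J / K\<close> for ideals \<open>K \<subseteq> J\<close>. The ring-multiplication fields
  of the record play no role for modules.\<close>

definition quotient_module ::
    "('a, 'b) ring_scheme \<Rightarrow> 'a set \<Rightarrow> 'a set \<Rightarrow> ('a, 'a set) module" where
  "quotient_module R J K =
     \<lparr> carrier = (\<lambda>x. K +>\<^bsub>R\<^esub> x) ` J,
       monoid.mult = undefined,
       monoid.one = undefined,
       zero = K,
       add = (\<lambda>X Y. X <+>\<^bsub>R\<^esub> Y),
       smult = (\<lambda>a X. \<Union>x\<in>X. K +>\<^bsub>R\<^esub> (a \<otimes>\<^bsub>R\<^esub> x)) \<rparr>"


definition graded_filtration :: "('a, 'b) ring_scheme \<Rightarrow> (nat \<Rightarrow> 'a set) \<Rightarrow> bool" where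
  "graded_filtration R I \<longleftrightarrow>
     (\<forall>n. ideal (I n) R) \<and>
     I 0 = carrier R \<and>
     (\<forall>m n. I m \<cdot>\<^bsub>R\<^esub> I n \<subseteq> I (m + n)) \<and>
     (\<forall>n\<ge>1. I n \<subset> carrier R) \<and>
     (\<forall>n\<ge>1. I (Suc n) \<subseteq> I n)"

definition rees_algebra :: "('a, 'b) ring_scheme \<Rightarrow> (nat \<Rightarrow> 'a set) \<Rightarrow> (nat \<Rightarrow> 'a) set" where
  "rees_algebra R I = {p \<in> carrier (UP R). \<forall>n. coeff (UP R) p n \<in> I n}"

text \<open>The \<open>R\<close>-subalgebra of \<open>R[t]\<close> generated by \<open>S\<close> is the subring generated by \<open>S\<close>
  together with the constant polynomials.\<close>

definition noetherian_filtration :: "('a, 'b) ring_scheme \<Rightarrow> (nat \<Rightarrow> 'a set) \<Rightarrow> bool" where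
  "noetherian_filtration R I \<longleftrightarrow>
     (\<exists>S. finite S \<and> S \<subseteq> rees_algebra R I \<and>
        rees_algebra R I =
          generate_ring (UP R) (S \<union> (\<lambda>c. monom (UP R) c 0) ` carrier R))"

text \<open>A family of \<open>s\<close> filtrations is indexed by a finite type \<open>'s\<close> with \<open>s = CARD('s)\<close>;
  accordingly \<open>\<nat>\<^sup>s\<close> is the function type \<open>'s \<Rightarrow> nat\<close>. Products and powers of
  ideals are taken in the commutative monoid \<open>ideals_set R\<close>, so that \<open>I\<^sup>0 = R\<close>.\<close>

definition common_veronese_index ::
    "('a, 'b) ring_scheme \<Rightarrow> ('s \<Rightarrow> nat \<Rightarrow> 'a set) \<Rightarrow> nat \<Rightarrow> bool" where
  "common_veronese_index R I q \<longleftrightarrow>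
     q \<ge> 1 \<and> (\<forall>j v. I j (q * v) = I j q [^]\<^bsub>ideals_set R\<^esub> v)"

definition stable_presentation ::
    "('a, 'b) ring_scheme \<Rightarrow> ('s \<Rightarrow> nat \<Rightarrow> 'a set) \<Rightarrow> nat \<Rightarrow> nat \<Rightarrow> bool" where
  "stable_presentation R I q a \<longleftrightarrow>
     a \<ge> 1 \<and>
     (\<forall>j r m. r < q \<longrightarrow> a \<le> m \<longrightarrow>
        I j (q * m + r) = (I j q [^]\<^bsub>ideals_set R\<^esub> (m - a)) \<cdot>\<^bsub>R\<^esub> I j (q * a + r))"


definition multi_power ::
    "('a, 'b) ring_scheme \<Rightarrow> ('s::finite \<Rightarrow> 'a set) \<Rightarrow> ('s \<Rightarrow> nat) \<Rightarrow> 'a set" where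
  "multi_power R J u =
     finprod (ideals_set R) (\<lambda>j. J j [^]\<^bsub>ideals_set R\<^esub> u j) UNIV"

definition diag_length ::
    "('a, 'b) ring_scheme \<Rightarrow> ('s::finite \<Rightarrow> 'a set) \<Rightarrow> nat \<Rightarrow> ('s \<Rightarrow> nat) \<Rightarrow> enat" where
  "diag_length R J r u =
     module_length R
       (quotient_module R (multi_power R J u)
          (((max_ideal R [^]\<^bsub>ideals_set R\<^esub> (r + 1)) \<cdot>\<^bsub>R\<^esub> multi_power R J u)
             <+>\<^bsub>R\<^esub> multi_power R J (\<lambda>j. u j + 1)))"

definition multi_degree :: "('s::finite \<Rightarrow> nat) \<Rightarrow> nat" where
  "multi_degree \<alpha> = (\<Sum>j\<in>UNIV. \<alpha> j)"

text \<open>A polynomial in \<open>r, u\<^sub>1, \<dots>, u\<^sub>s\<close> is given by its coefficients: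
  \<open>p k \<beta>\<close> is the coefficient of \<open>r\<^sup>k u\<^sup>\<beta>\<close>. \<open>poly_value D\<close> evaluates polynomials of
  total degree at most \<open>D\<close>.\<close>

definition total_degree_le :: "nat \<Rightarrow> (nat \<Rightarrow> ('s::finite \<Rightarrow> nat) \<Rightarrow> real) \<Rightarrow> bool" where
  "total_degree_le D p \<longleftrightarrow> (\<forall>k \<beta>. p k \<beta> \<noteq> 0 \<longrightarrow> k + multi_degree \<beta> \<le> D)"

definition poly_value ::
    "nat \<Rightarrow> (nat \<Rightarrow> ('s::finite \<Rightarrow> nat) \<Rightarrow> real) \<Rightarrow> nat \<Rightarrow> ('s \<Rightarrow> nat) \<Rightarrow> real" where
  "poly_value D p r u =
     (\<Sum>(k, \<beta>) \<in> {(k, \<beta>). k + multi_degree \<beta> \<le> D}.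
        p k \<beta> * real r ^ k * (\<Prod>j\<in>UNIV. real (u j) ^ \<beta> j))"

definition is_diag_polynomial ::
    "('a, 'b) ring_scheme \<Rightarrow> ('s::finite \<Rightarrow> 'a set) \<Rightarrow>
     (nat \<Rightarrow> ('s \<Rightarrow> nat) \<Rightarrow> real) \<Rightarrow> bool" where
  "is_diag_polynomial R J p \<longleftrightarrow>
     (let D = the_enat (krull_dim R) - 1 in
        total_degree_le D p \<and>
        (\<exists>N. \<forall>r u. r \<ge> N \<longrightarrow> (\<forall>j. u j \<ge> N) \<longrightarrow>
           ereal_of_enat (diag_length R J r u) = ereal (poly_value D p r u)))"

text \<open>The coefficient of \<open>r\<^bsup>d-i\<^esup> u\<^sup>\<alpha>\<close> in the polynomial is
  \<open>c\<^sub>i\<^sub>,\<^sub>\<alpha> / ((d-i)! \<alpha>!)\<close>. Meaningful for \<open>1 \<le> i \<le> d\<close> and \<open>multi_degree \<alpha> = i - 1\<close>.\<close>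

definition diag_component ::
    "('a, 'b) ring_scheme \<Rightarrow> ('s::finite \<Rightarrow> 'a set) \<Rightarrow> nat \<Rightarrow> ('s \<Rightarrow> nat) \<Rightarrow> real" where
  "diag_component R J i \<alpha> =
     (let d = the_enat (krull_dim R) in
        fact (d - i) * (\<Prod>j\<in>UNIV. fact (\<alpha> j)) *
          (THE p. is_diag_polynomial R J p) (d - i) \<alpha>)"

definition filtration_diag_component ::
    "('a, 'b) ring_scheme \<Rightarrow> ('s::finite \<Rightarrow> nat \<Rightarrow> 'a set) \<Rightarrow> nat \<Rightarrow> ('s \<Rightarrow> nat) \<Rightarrow> real" where
  "filtration_diag_component R I i \<alpha> =
     lim (\<lambda>n. diag_component R (\<lambda>j. I j n) i \<alpha> / real n ^ i)"

end

theory Submission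
  imports Defs "HOL-Real_Asymp.Real_Asymp"
begin

text \<open>A Noetherian filtration is generated by finitely many homogeneous elements of positive degree, so
  \<open>I\<^sub>N\<close> is the ideal generated by the monomials of weighted degree \<open>N\<close> in these generators. Let \<open>L\<close> be
  the product of the degrees of the \<open>g\<close> generators. By the pigeonhole principle a monomial of degree at
  least \<open>(g + i) L\<close> has a divisor of degree exactly \<open>i L\<close>, which makes \<open>q = (g + 1) L\<close> a Veronese
  index, and so is every multiple of it; this gives a common one for several filtrations. Given \<open>q\<close>
  and \<open>a\<close>, the assumption controls the diagonal components along each residue class modulo \<open>q\<close>, because \<open>I\<^bsub>q(m+a)+r\<^esub> = J\<^sup>m K\<^sub>r\<close>, and the limits along
  the residue classes agree.\<close>

section \<open>Products and sums of elements of generated ideals\<close>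

context cring
begin

text \<open>This is the colon ideal \<open>K : Y\<close>. Being an ideal, it contains
  \<open>Idl A\<close> as soon as it contains \<open>A\<close>, so a statement about products need
  only be checked on generators.\<close>

lemma ideal_colon:
  assumes "ideal K R" "Y \<subseteq> carrier R"
  shows "ideal {x \<in> carrier R. \<forall>y\<in>Y. x \<otimes> y \<in> K} R"
proof -
  interpret K: ideal K R by fact
  show ?thesis
  proof (rule idealI)
    show "subgroup {x \<in> carrier R. \<forall>y\<in>Y. x \<otimes> y \<in> K} (add_monoid R)"
    proof
      show "x \<otimes>\<^bsub>add_monoid R\<^esub> y \<in> {x \<in> carrier R. \<forall>y\<in>Y. x \<otimes> y \<in> K}"
        if "x \<in> {x \<in> carrier R. \<forall>y\<in>Y. x \<otimes> y \<in> K}" "y \<in> {x \<in> carrier R. \<forall>y\<in>Y. x \<otimes> y \<in> K}" for x y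
        using that assms(2) by (auto simp: l_distr subset_iff)
    next
      show "inv\<^bsub>add_monoid R\<^esub> x \<in> {x \<in> carrier R. \<forall>y\<in>Y. x \<otimes> y \<in> K}"
        if "x \<in> {x \<in> carrier R. \<forall>y\<in>Y. x \<otimes> y \<in> K}" for x
        using that assms(2) by (auto simp: l_minus subset_iff a_inv_def[symmetric])
    qed (use assms(2) in auto)
  next
    fix a x assume "a \<in> {x \<in> carrier R. \<forall>y\<in>Y. x \<otimes> y \<in> K}" "x \<in> carrier R"
    then show "x \<otimes> a \<in> {x \<in> carrier R. \<forall>y\<in>Y. x \<otimes> y \<in> K}"
      "a \<otimes> x \<in> {x \<in> carrier R. \<forall>y\<in>Y. x \<otimes> y \<in> K}"
      using assms(2) by (auto simp: m_assoc subset_iff K.I_l_closed m_comm[of a x])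
  qed (rule ring_axioms)
qed

text \<open>The colon ideal is used twice: \<open>A\<close> lies in \<open>K : B\<close>, hence so
  does \<open>Idl A\<close>; then \<open>B\<close> lies in \<open>K : Idl A\<close>, hence so does
  \<open>Idl B\<close>.\<close>

lemma genideal_mult_mem:
  assumes "A \<subseteq> carrier R" "B \<subseteq> carrier R" "ideal K R"
    and AB: "\<And>x y. x \<in> A \<Longrightarrow> y \<in> B \<Longrightarrow> x \<otimes> y \<in> K"
    and "x \<in> Idl A" "y \<in> Idl B"
  shows "x \<otimes> y \<in> K"
proof -
  have IA: "Idl A \<subseteq> carrier R"
    using genideal_ideal[OF assms(1)] by (simp add: additive_subgroup.a_subset ideal.axioms(1))
  have *: "x \<otimes> b \<in> K" if "b \<in> B" "x \<in> Idl A" for x b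
    using genideal_minimal[OF ideal_colon[OF assms(3,2)], of A] that AB assms(1) by blast
  have "b \<otimes> a \<in> K" if "b \<in> B" "a \<in> Idl A" for a b
    using *[OF that] that assms(2) IA by (metis m_comm subsetD)
  then have "y \<otimes> x \<in> K"
    using genideal_minimal[OF ideal_colon[OF assms(3) IA], of B] assms(2,5,6) by blast
  then show ?thesis
    using IA genideal_ideal[OF assms(2)] assms(5,6)
    by (metis m_comm subsetD ideal.Icarr)
qed

lemma ideal_finsum_mem:
  assumes "ideal K R" "finite A" "\<And>i. i \<in> A \<Longrightarrow> f i \<in> K"
  shows "(\<Oplus>i\<in>A. f i) \<in> K"
proof -
  interpret K: ideal K R by fact
  have "f ` B \<subseteq> K \<Longrightarrow> (\<Oplus>i\<in>B. f i) \<in> K" if "finite B" for B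
    using that
  proof (induction B)
    case (insert b B)
    then have "f \<in> B \<rightarrow> carrier R" "f b \<in> carrier R" by auto
    with insert show ?case by (simp add: finsum_insert)
  qed simp
  with assms(2,3) show ?thesis by blast
qed

section \<open>Weighted monomials in homogeneous generators\<close>

text \<open>The pair \<open>(n, x)\<close> stands for the homogeneous element \<open>x t^n\<close>
  of \<open>R[t]\<close>. The degree is stored with the element because the same \<open>x\<close>
  may be a generator in several degrees.\<close>

definition wmonom :: "(nat \<times> 'a) set \<Rightarrow> (nat \<times> 'a \<Rightarrow> nat) \<Rightarrow> 'a" where
  "wmonom G e = (\<Otimes>g\<in>G. snd g [^] e g)"

text \<open>For finite \<open>G\<close> in \<open>R\<close> this is the degree \<open>N\<close> part
  of the \<open>R\<close>-algebra generated by the elements \<open>x t^n\<close> with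
  \<open>(n, x)\<close> in \<open>G\<close>. It is the zero ideal if no monomial has weight
  \<open>N\<close>.\<close>

definition wmonom_ideal :: "(nat \<times> 'a) set \<Rightarrow> nat \<Rightarrow> 'a set" where
  "wmonom_ideal G N = Idl {wmonom G e | e. (\<Sum>g\<in>G. e g * fst g) = N}"

lemma wmonom_closed: "snd ` G \<subseteq> carrier R \<Longrightarrow> wmonom G e \<in> carrier R"
  unfolding wmonom_def by (rule finprod_closed) auto

lemma wmonom_add:
  assumes "snd ` G \<subseteq> carrier R"
  shows "wmonom G (\<lambda>g. e g + f g) = wmonom G e \<otimes> wmonom G f"
proof -
  have "wmonom G (\<lambda>g. e g + f g) = (\<Otimes>g\<in>G. snd g [^] e g \<otimes> snd g [^] f g)"
    unfolding wmonom_def using assms by (intro finprod_cong') (auto simp: nat_pow_mult)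
  also have "\<dots> = wmonom G e \<otimes> wmonom G f"
    unfolding wmonom_def using assms by (intro finprod_multf) auto
  finally show ?thesis .
qed

lemma wmonom_ideal_is_ideal: "snd ` G \<subseteq> carrier R \<Longrightarrow> ideal (wmonom_ideal G N) R"
  unfolding wmonom_ideal_def by (rule genideal_ideal) (auto intro: wmonom_closed)

lemma wmonom_mem: "snd ` G \<subseteq> carrier R \<Longrightarrow> wmonom G e \<in> wmonom_ideal G (\<Sum>g\<in>G. e g * fst g)"
  unfolding wmonom_ideal_def by (rule subsetD[OF genideal_self]) (auto intro: wmonom_closed)

lemma wmonom_ideal_minimal:
  assumes "ideal K R" "\<And>e. (\<Sum>g\<in>G. e g * fst g) = N \<Longrightarrow> wmonom G e \<in> K"
  shows "wmonom_ideal G N \<subseteq> K"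
  unfolding wmonom_ideal_def using assms by (intro genideal_minimal) auto

text \<open>Exponents add under multiplication, and weights with them;
  \<open>genideal_mult_mem\<close> passes from monomials to the ideals they generate.\<close>

lemma wmonom_ideal_mult:
  assumes G: "snd ` G \<subseteq> carrier R"
    and "x \<in> wmonom_ideal G m" "y \<in> wmonom_ideal G n"
  shows "x \<otimes> y \<in> wmonom_ideal G (m + n)"
proof (rule genideal_mult_mem[OF _ _ _ _ assms(2,3)[unfolded wmonom_ideal_def]])
  fix x y
  assume "x \<in> {wmonom G e | e. (\<Sum>g\<in>G. e g * fst g) = m}"
    and "y \<in> {wmonom G e | e. (\<Sum>g\<in>G. e g * fst g) = n}"
  then obtain e f where "x = wmonom G e" "(\<Sum>g\<in>G. e g * fst g) = m"
    "y = wmonom G f" "(\<Sum>g\<in>G. f g * fst g) = n" by auto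
  then show "x \<otimes> y \<in> wmonom_ideal G (m + n)"
    using wmonom_mem[OF G, of "\<lambda>g. e g + f g"]
    by (simp add: wmonom_add[OF G] add_mult_distrib sum.distrib)
qed (auto intro: wmonom_closed[OF G] wmonom_ideal_is_ideal[OF G])

lemma wmonom_ideal_zero: "snd ` G \<subseteq> carrier R \<Longrightarrow> wmonom_ideal G 0 = carrier R"
proof -
  assume G: "snd ` G \<subseteq> carrier R"
  have "wmonom G (\<lambda>_. 0) = \<one>"
    unfolding wmonom_def by (simp add: finprod_one_eqI)
  then show ?thesis
    using wmonom_mem[OF G, of "\<lambda>_. 0"] ideal.one_imp_carrier[OF wmonom_ideal_is_ideal[OF G]] by simp
qed

lemma wmonom_ideal_generator:
  assumes G: "snd ` G \<subseteq> carrier R" and "finite G" "(n, x) \<in> G"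
  shows "x \<in> wmonom_ideal G n"
proof -
  let ?e = "\<lambda>g. if g = (n, x) then 1 else 0 :: nat"
  have x: "x \<in> carrier R" using assms by force
  have "wmonom G ?e = (\<Otimes>g\<in>G. if (n, x) = g then snd g else \<one>)"
    unfolding wmonom_def using G by (intro finprod_cong') auto
  also have "\<dots> = snd (n, x)"
    by (rule finprod_singleton) (use assms in auto)
  also have "\<dots> = x" by simp
  finally have "wmonom G ?e = x" .
  moreover have "(\<Sum>g\<in>G. ?e g * fst g) = (\<Sum>g\<in>G. if g = (n, x) then n else 0)"
    by (intro sum.cong) auto
  then have "(\<Sum>g\<in>G. ?e g * fst g) = n"
    using assms by simp
  ultimately show ?thesis using wmonom_mem[OF G, of ?e] by simp
qed

section \<open>Noetherian filtrations as ideals of weighted monomials\<close>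

lemma graded_filtrationD:
  assumes "graded_filtration R I"
  shows "ideal (I n) R" "I 0 = carrier R" "I m \<cdot> I n \<subseteq> I (m + n)"
  using assms unfolding graded_filtration_def by blast+

lemma graded_filtration_mult:
  assumes "graded_filtration R I" "x \<in> I m" "y \<in> I n"
  shows "x \<otimes> y \<in> I (m + n)"
  using graded_filtrationD(3)[OF assms(1), of m n] ideal_prod.prod[OF assms(2,3)] by (rule subsetD)

lemma wmonom_in_filtration:
  assumes I: "graded_filtration R I" and "finite G" "\<And>n x. (n, x) \<in> G \<Longrightarrow> x \<in> I n"
  shows "wmonom G e \<in> I (\<Sum>g\<in>G. e g * fst g)"
  using assms(2,3)
proof (induction G)
  case empty
  then show ?case by (simp add: wmonom_def graded_filtrationD(2)[OF I])
next
  case (insert g G)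
  have pow: "x [^] k \<in> I (k * n)" if "x \<in> I n" for x n and k :: nat
    using that
  proof (induction k)
    case (Suc k)
    then show ?case using graded_filtration_mult[OF I, of "x [^] k" "k * n" x n] by (simp add: add.commute)
  qed (simp add: graded_filtrationD(2)[OF I])
  have carr: "snd h \<in> carrier R" if "h \<in> insert g G" for h
    using that insert.prems[of "fst h" "snd h"] ideal.Icarr[OF graded_filtrationD(1)[OF I]] by simp
  have "wmonom (insert g G) e = snd g [^] e g \<otimes> wmonom G e"
    unfolding wmonom_def by (rule finprod_insert) (use insert.hyps carr in auto)
  moreover have "snd g [^] e g \<in> I (e g * fst g)"
    using insert.prems by (intro pow) auto
  ultimately show ?case
    using insert graded_filtration_mult[OF I] by simp
qed

text \<open>The homogeneous generators are the coefficients of finitely many algebra generators of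
  the Rees algebra. The polynomials whose \<open>n\<close>-th coefficient lies in
  \<open>wmonom_ideal G n\<close> form a subring containing these generators and the constants,
  hence the whole Rees algebra.\<close>

lemma noetherian_filtration_wmonom:
  assumes I: "graded_filtration R I" and "noetherian_filtration R I"
  obtains G where "finite G" "\<And>n x. (n, x) \<in> G \<Longrightarrow> 1 \<le> n \<and> x \<in> I n"
    "\<And>N. I N = wmonom_ideal G N"
proof -
  interpret P: UP_cring R "UP R" by unfold_locales
  obtain S where S: "finite S" "S \<subseteq> rees_algebra R I"
    and gen: "rees_algebra R I =
      generate_ring (UP R) (S \<union> (\<lambda>c. monom (UP R) c 0) ` carrier R)"
    using assms(2) unfolding noetherian_filtration_def by blast
  \<comment> \<open>Constant coefficients are left out: \<open>wmonom_ideal G 0\<close> is all of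
    \<open>R\<close> anyway, and all weights stay positive.\<close>
  define G where "G = (\<Union>p\<in>S. (\<lambda>n. (n, coeff (UP R) p n)) ` {1..deg R p})"
  have finG: "finite G" unfolding G_def using S(1) by auto
  have G: "1 \<le> n \<and> x \<in> I n" if "(n, x) \<in> G" for n x
    using that S(2) unfolding G_def rees_algebra_def by auto
  have Gc: "snd ` G \<subseteq> carrier R"
    using G ideal.Icarr[OF graded_filtrationD(1)[OF I]] by force
  let ?M = "wmonom_ideal G"
  let ?T = "{p \<in> carrier (UP R). \<forall>n. coeff (UP R) p n \<in> ?M n}"
  have id: "ideal (?M n) R" for n by (rule wmonom_ideal_is_ideal[OF Gc])
  have zero: "\<zero> \<in> ?M n" for n
    using id additive_subgroup.zero_closed ideal.axioms(1) by blast
  have "generate_ring (UP R) (S \<union> (\<lambda>c. monom (UP R) c 0) ` carrier R) \<subseteq> ?T"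
  proof (rule P.P.generate_ring_min_subring1)
    show "S \<union> (\<lambda>c. monom (UP R) c 0) ` carrier R \<subseteq> carrier (UP R)"
      using S(2) by (auto simp: rees_algebra_def)
    show "subring ?T (UP R)"
    proof (rule P.P.subringI)
      show "\<one>\<^bsub>UP R\<^esub> \<in> ?T"
        using wmonom_ideal_zero[OF Gc] zero by auto
    next
      fix p assume "p \<in> ?T"
      then show "\<ominus>\<^bsub>UP R\<^esub> p \<in> ?T"
        using additive_subgroup.a_inv_closed[OF ideal.axioms(1)[OF id]] by auto
    next
      fix p p' assume p: "p \<in> ?T" "p' \<in> ?T"
      then show "p \<oplus>\<^bsub>UP R\<^esub> p' \<in> ?T"
        using additive_subgroup.a_closed[OF ideal.axioms(1)[OF id]] by auto
      \<comment> \<open>The \<open>n\<close>-th coefficient of a product is a convolution sum, and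
        each summand has total weight \<open>i + (n - i) = n\<close>.\<close>
      have "coeff (UP R) p i \<otimes> coeff (UP R) p' (n - i) \<in> ?M n" if "i \<le> n" for i n
        using wmonom_ideal_mult[OF Gc, of _ i _ "n - i"] p that by auto
      then show "p \<otimes>\<^bsub>UP R\<^esub> p' \<in> ?T"
        using p by (auto intro!: ideal_finsum_mem[OF id])
    qed auto
    show "S \<union> (\<lambda>c. monom (UP R) c 0) ` carrier R \<subseteq> ?T"
    proof
      fix p assume "p \<in> S \<union> (\<lambda>c. monom (UP R) c 0) ` carrier R"
      then consider "p \<in> S" | c where "c \<in> carrier R" "p = monom (UP R) c 0" by auto
      then show "p \<in> ?T"
      proof cases
        case 1
        then have p: "p \<in> carrier (UP R)" using S(2) by (auto simp: rees_algebra_def)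
        have "coeff (UP R) p n \<in> ?M n" for n
        proof -
          \<comment> \<open>Degree 0 imposes no condition, the coefficients up to the degree of
            \<open>p\<close> are generators, and the later ones vanish.\<close>
          consider "n = 0" | "1 \<le> n" "n \<le> deg R p" | "deg R p < n" by linarith
          then show ?thesis
          proof cases
            case 1
            then show ?thesis using wmonom_ideal_zero[OF Gc] p by simp
          next
            case 2
            then show ?thesis
              using \<open>p \<in> S\<close> by (intro wmonom_ideal_generator[OF Gc finG]) (force simp: G_def)
          next
            case 3
            then show ?thesis using P.deg_aboveD[OF _ p] zero by simp
          qed
        qed
        with p show ?thesis by simp
      next
        case 2
        then show ?thesis using wmonom_ideal_zero[OF Gc] zero by auto
      qed
    qed
  qed
  then have sub: "rees_algebra R I \<subseteq> ?T" using gen by simp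
  have "I N = ?M N" for N
  proof
    show "I N \<subseteq> ?M N"
    proof
      fix y assume y: "y \<in> I N"
      then have yc: "y \<in> carrier R" by (rule ideal.Icarr[OF graded_filtrationD(1)[OF I]])
      \<comment> \<open>The inclusion of Rees algebras is read off degree by degree:
        \<open>y t^N\<close> lies in the Rees algebra, and \<open>y\<close> is its coefficient in
        degree \<open>N\<close>.\<close>
      have "monom (UP R) y N \<in> rees_algebra R I"
        using y yc additive_subgroup.zero_closed[OF ideal.axioms(1)[OF graded_filtrationD(1)[OF I]]]
        by (auto simp: rees_algebra_def)
      with sub have "coeff (UP R) (monom (UP R) y N) N \<in> ?M N" by blast
      then show "y \<in> ?M N" using yc by simp
    qed
    show "?M N \<subseteq> I N"
      using wmonom_in_filtration[OF I finG] G
      by (intro wmonom_ideal_minimal graded_filtrationD(1)[OF I]) blast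
  qed
  with that finG G show thesis by blast
qed

section \<open>Powers in the monoid of ideals\<close>

lemma ideal_prod_mono:
  assumes "A \<subseteq> A'" "B \<subseteq> B'"
  shows "A \<cdot> B \<subseteq> A' \<cdot> B'"
proof
  fix x assume "x \<in> A \<cdot> B"
  then show "x \<in> A' \<cdot> B'"
    by induction (use assms in \<open>auto intro: ideal_prod.intros\<close>)
qed

lemma ideals_set_simps:
  "carrier (ideals_set R) = {I. ideal I R}" "monoid.mult (ideals_set R) = ideal_prod R"
  "monoid.one (ideals_set R) = carrier R"
  by (simp_all add: ideals_set_def)

lemma ideals_set_monoid: "monoid (ideals_set R)"
  using ideals_set_is_comm_monoid by (rule comm_monoid.axioms(1))

text \<open>Both sides are \<open>I q\<close> to the power \<open>k * v\<close>. Passing to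
  multiples is what gives several filtrations a common index.\<close>

lemma veronese_multiple:
  fixes q k v :: nat
  assumes "ideal (I q) R" "\<And>v. I (q * v) = I q [^]\<^bsub>ideals_set R\<^esub> v"
  shows "I ((q * k) * v) = I (q * k) [^]\<^bsub>ideals_set R\<^esub> v"
  using assms monoid.nat_pow_pow[OF ideals_set_monoid, of "I q" k v]
  by (simp add: ideals_set_simps mult.assoc)

end

section \<open>Splitting exponents by the pigeonhole principle\<close>

text \<open>Blocks of weight exactly \<open>L\<close> are removed one at a time. As long as the
  total exceeds \<open>card G * L\<close>, some single \<open>g\<close> contributes at least
  \<open>L\<close>, and \<open>L div w g\<close> copies of it form such a block. The slack
  \<open>card G * L\<close> keeps this possible for \<open>i\<close> rounds.\<close>

lemma weighted_sum_split:
  fixes w e :: "'b \<Rightarrow> nat"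
  assumes "finite G" "L > 0" "\<And>g. g \<in> G \<Longrightarrow> w g dvd L"
    and "(card G + i) * L \<le> (\<Sum>g\<in>G. e g * w g)"
  shows "\<exists>e1 e2. (\<forall>g. e g = e1 g + e2 g) \<and> (\<Sum>g\<in>G. e1 g * w g) = i * L"
  using assms(4)
proof (induction i arbitrary: e)
  case 0
  show ?case by (rule exI[of _ "\<lambda>_. 0"]) auto
next
  case (Suc i)
  have "\<exists>g\<in>G. L \<le> e g * w g"
  proof (rule ccontr)
    assume "\<not> ?thesis"
    then have "(\<Sum>g\<in>G. e g * w g) \<le> card G * L"
      using sum_bounded_above[of G "\<lambda>g. e g * w g" L] by force
    with Suc.prems \<open>L > 0\<close> show False by (simp add: add_mult_distrib)
  qed
  then obtain g where g: "g \<in> G" "L \<le> e g * w g" by blast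
  \<comment> \<open>Divisibility makes \<open>k\<close> copies of \<open>g\<close> weigh exactly
    \<open>L\<close>, and \<open>k \<le> e g\<close> makes the truncated subtraction in
    \<open>e'\<close> exact.\<close>
  define k where "k = L div w g"
  have k: "k * w g = L" using assms(3)[OF g(1)] by (simp add: k_def)
  have "k \<le> e g"
    using g(2) k \<open>L > 0\<close> by (metis mult_le_cancel2 mult_0_right neq0_conv)
  define \<delta> where "\<delta> = (\<lambda>h. if h = g then k else 0)"
  have \<delta>: "(\<Sum>h\<in>G. \<delta> h * w h) = L"
  proof -
    have "(\<Sum>h\<in>G. \<delta> h * w h) = (\<Sum>h\<in>G. if h = g then k * w g else 0)"
      by (intro sum.cong) (auto simp: \<delta>_def)
    then show ?thesis using assms(1) g(1) k by simp
  qed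
  define e' where "e' = (\<lambda>h. e h - \<delta> h)"
  have e: "e h = e' h + \<delta> h" for h
    using \<open>k \<le> e g\<close> by (auto simp: e'_def \<delta>_def)
  have "(\<Sum>h\<in>G. e h * w h) = (\<Sum>h\<in>G. e' h * w h) + L"
    using \<delta> by (simp add: e add_mult_distrib sum.distrib)
  then have "(card G + i) * L \<le> (\<Sum>h\<in>G. e' h * w h)"
    using Suc.prems by (simp add: add_mult_distrib)
  from Suc.IH[OF this] obtain e1 e2 where
    "\<forall>h. e' h = e1 h + e2 h" "(\<Sum>h\<in>G. e1 h * w h) = i * L" by blast
  then have "(\<forall>h. e h = (e1 h + \<delta> h) + e2 h) \<and> (\<Sum>h\<in>G. (e1 h + \<delta> h) * w h) = Suc i * L"
    using \<delta> by (simp add: e add_mult_distrib sum.distrib)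
  then show ?case by (intro exI[of _ "\<lambda>h. e1 h + \<delta> h"] exI[of _ e2])
qed

section \<open>Existence of Veronese indices and stable presentations\<close>

context cring
begin

lemma noetherian_filtration_veronese:
  assumes I: "graded_filtration R I" and "noetherian_filtration R I"
  shows "\<exists>q\<ge>1. \<forall>v. I (q * v) = I q [^]\<^bsub>ideals_set R\<^esub> v"
proof -
  interpret M: comm_monoid "ideals_set R" by (rule ideals_set_is_comm_monoid)
  obtain G where finG: "finite G" and G: "\<And>n x. (n, x) \<in> G \<Longrightarrow> 1 \<le> n \<and> x \<in> I n"
    and eq: "\<And>N. I N = wmonom_ideal G N"
    using noetherian_filtration_wmonom[OF assms] by blast
  have id: "ideal (I n) R" for n by (rule graded_filtrationD(1)[OF I])
  have Gc: "snd ` G \<subseteq> carrier R" using G ideal.Icarr[OF id] by force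
  \<comment> \<open>A common multiple of all generator degrees; it is 1 if there are no
    generators.\<close>
  define L where "L = (\<Prod>g\<in>G. fst g)"
  have L: "L > 0" "\<And>g. g \<in> G \<Longrightarrow> fst g dvd L"
    using finG G by (force simp: L_def intro!: prod_pos, simp add: L_def dvd_prodI)
  define q where "q = Suc (card G) * L"
  \<comment> \<open>A divisor of weight exactly \<open>q\<close> is split off each monomial. This
    needs weight at least \<open>(2 * card G + 1) * L\<close>, which \<open>2 * q\<close>
    guarantees; hence the recursion starts at exponent 2, the exponents 0 and 1 being
    immediate.\<close>
  have step: "I (q * Suc (Suc v)) = I q \<cdot> I (q * Suc v)" for v
  proof
    show "I q \<cdot> I (q * Suc v) \<subseteq> I (q * Suc (Suc v))"
      using graded_filtrationD(3)[OF I, of q "q * Suc v"] by simp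
    have "wmonom G e \<in> I q \<cdot> I (q * Suc v)"
      if e: "(\<Sum>g\<in>G. e g * fst g) = q * Suc (Suc v)" for e
    proof -
      have "(card G + Suc (card G)) * L \<le> 2 * q"
        by (simp add: q_def algebra_simps)
      also have "\<dots> \<le> (\<Sum>g\<in>G. e g * fst g)"
        by (simp add: e)
      finally obtain e1 e2 where e12: "\<forall>g. e g = e1 g + e2 g" "(\<Sum>g\<in>G. e1 g * fst g) = q"
        using weighted_sum_split[where w = fst and i = "Suc (card G)" and e = e, OF finG L]
        unfolding q_def by blast
      then have "(\<Sum>g\<in>G. e2 g * fst g) = q * Suc v"
        using e by (simp add: add_mult_distrib sum.distrib del: split_paired_All)
      with e12(2) have "wmonom G e1 \<in> I q" "wmonom G e2 \<in> I (q * Suc v)"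
        using wmonom_mem[OF Gc, of e1] wmonom_mem[OF Gc, of e2] by (simp_all add: eq)
      moreover have "wmonom G e = wmonom G e1 \<otimes> wmonom G e2"
        using wmonom_add[OF Gc, of e1 e2] e12(1) by presburger
      ultimately show ?thesis by (simp add: ideal_prod.prod)
    qed
    then show "I (q * Suc (Suc v)) \<subseteq> I q \<cdot> I (q * Suc v)"
      unfolding eq[of "q * Suc (Suc v)"]
      by (intro wmonom_ideal_minimal ideal_prod_is_ideal id)
  qed
  have "I (q * v) = I q [^]\<^bsub>ideals_set R\<^esub> v" for v
  proof (induction v)
    case 0
    then show ?case by (simp add: graded_filtrationD(2)[OF I] ideals_set_simps)
  next
    case (Suc v)
    show ?case
    proof (cases v)
      case 0
      then show ?thesis using id M.nat_pow_eone[of "I q"] by (simp add: ideals_set_simps)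
    next
      case (Suc u)
      then show ?thesis
        using step[of u] Suc.IH ideal_prod_commute[OF id id, of q "q * v"] by (simp add: ideals_set_simps)
    qed
  qed
  moreover have "q \<ge> 1" using L by (simp add: q_def)
  ultimately show ?thesis by blast
qed

text \<open>Splitting every exponent as \<open>q * (e div q) + e mod q\<close>, the second part has bounded degree,
  while the first has degree divisible by \<open>q\<close>.\<close>

lemma veronese_stable:
  assumes I: "graded_filtration R I" and "noetherian_filtration R I"
    and q: "q \<ge> 1" and ver: "\<And>v. I (q * v) = I q [^]\<^bsub>ideals_set R\<^esub> v"
  shows "\<exists>B. \<forall>a\<ge>B. \<forall>m\<ge>a. \<forall>r<q.
    I (q * m + r) = (I q [^]\<^bsub>ideals_set R\<^esub> (m - a)) \<cdot> I (q * a + r)"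
proof -
  interpret M: comm_monoid "ideals_set R" by (rule ideals_set_is_comm_monoid)
  obtain G where finG: "finite G" and G: "\<And>n x. (n, x) \<in> G \<Longrightarrow> 1 \<le> n \<and> x \<in> I n"
    and eq: "\<And>N. I N = wmonom_ideal G N"
    using noetherian_filtration_wmonom[OF assms(1,2)] by blast
  have id: "ideal (I n) R" for n by (rule graded_filtrationD(1)[OF I])
  have Gc: "snd ` G \<subseteq> carrier R" using G ideal.Icarr[OF id] by force
  \<comment> \<open>The remainders \<open>e g mod q\<close> are below \<open>q\<close>, so the
    remainder monomial has weight at most \<open>q * B\<close>.\<close>
  define B where "B = (\<Sum>g\<in>G. fst g)"
  have "I (q * m + r) = I (q * (m - a)) \<cdot> I (q * a + r)" if a: "B \<le> a" "a \<le> m" and r: "r < q" for a m r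
  proof
    have "q * (m - a) + (q * a + r) = q * m + r"
      using a(2) by (simp flip: add.assoc add_mult_distrib2)
    then show "I (q * (m - a)) \<cdot> I (q * a + r) \<subseteq> I (q * m + r)"
      using graded_filtrationD(3)[OF I, of "q * (m - a)" "q * a + r"] by metis
    have "wmonom G e \<in> I (q * (m - a)) \<cdot> I (q * a + r)"
      if e: "(\<Sum>g\<in>G. e g * fst g) = q * m + r" for e
    proof -
      define f where "f = (\<lambda>g. q * (e g div q))"
      define h where "h = (\<lambda>g. e g mod q)"
      define D where "D = (\<Sum>g\<in>G. h g * fst g)"
      define t where "t = D div q"
      have "D \<le> (\<Sum>g\<in>G. q * fst g)"
        unfolding D_def h_def using q by (intro sum_mono mult_right_mono) (simp_all add: less_imp_le)
      then have "D \<le> q * B" by (simp add: B_def sum_distrib_left)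
      then have "t \<le> B" using q unfolding t_def by (metis div_le_mono nonzero_mult_div_cancel_left not_one_le_zero)
      with a have t: "t \<le> a" by simp
      have fD: "(\<Sum>g\<in>G. f g * fst g) + D = q * m + r"
        unfolding e[symmetric] D_def sum.distrib[symmetric] add_mult_distrib[symmetric]
        by (simp add: f_def h_def)
      moreover have "(\<Sum>g\<in>G. f g * fst g) = q * (\<Sum>g\<in>G. e g div q * fst g)"
        by (simp add: f_def sum_distrib_left mult.assoc)
      \<comment> \<open>Modulo \<open>q\<close> only the remainder part of the weight survives, so
        \<open>D\<close> has the form \<open>q * t + r\<close>, with
        \<open>t \<le> B \<le> a\<close>.\<close>
      ultimately have "(q * (\<Sum>g\<in>G. e g div q * fst g) + D) mod q = (q * m + r) mod q" by simp
      then have "D mod q = r" using r by simp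
      then have D: "D = q * t + r" unfolding t_def by (metis mult_div_mod_eq)
      have f: "(\<Sum>g\<in>G. f g * fst g) = q * (m - t)"
        using fD D a t by (simp add: diff_mult_distrib2)
      \<comment> \<open>Since \<open>t \<le> a \<le> m\<close>, the power of \<open>I q\<close>
        containing \<open>wmonom G f\<close> splits: the exponent \<open>m - a\<close> gives the
        required factor, and the rest, \<open>a - t\<close>, is absorbed together with the remainder
        monomial into \<open>I (q * a + r)\<close>.\<close>
      have "I (q * (m - t)) = I (q * (m - a)) \<cdot> I (q * (a - t))"
        using M.nat_pow_mult[of "I q" "m - a" "a - t"] id a t by (simp add: ver ideals_set_simps)
      moreover have "wmonom G f \<in> I (q * (m - t))"
        using wmonom_mem[OF Gc, of f] by (simp add: eq f)
      moreover have "wmonom G h \<in> I (q * t + r)"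
        using wmonom_mem[OF Gc, of h] D by (simp add: eq D_def)
      ultimately have "wmonom G f \<otimes> wmonom G h \<in> I (q * (m - a)) \<cdot> I (q * (a - t)) \<cdot> I (q * t + r)"
        by (simp add: ideal_prod.prod)
      also have "\<dots> = I (q * (m - a)) \<cdot> (I (q * (a - t)) \<cdot> I (q * t + r))"
        by (intro ideal_prod_assoc id)
      also have "\<dots> \<subseteq> I (q * (m - a)) \<cdot> I (q * a + r)"
      proof (rule ideal_prod_mono)
        have "q * (a - t) + (q * t + r) = q * a + r"
          using t by (simp flip: add.assoc add_mult_distrib2)
        then show "I (q * (a - t)) \<cdot> I (q * t + r) \<subseteq> I (q * a + r)"
          using graded_filtrationD(3)[OF I, of "q * (a - t)" "q * t + r"] by metis
      qed simp
      also have "wmonom G f \<otimes> wmonom G h = wmonom G e"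
        using wmonom_add[OF Gc, of f h] by (simp add: f_def h_def)
      finally show ?thesis .
    qed
    then show "I (q * m + r) \<subseteq> I (q * (m - a)) \<cdot> I (q * a + r)"
      unfolding eq[of "q * m + r"]
      by (intro wmonom_ideal_minimal ideal_prod_is_ideal id)
  qed
  then show ?thesis unfolding ver[symmetric] by blast
qed

lemma common_veronese_index_exists:
  fixes I :: "'s::finite \<Rightarrow> nat \<Rightarrow> 'a set"
  assumes "\<And>j. graded_filtration R (I j)" "\<And>j. noetherian_filtration R (I j)"
  shows "\<exists>q. common_veronese_index R I q"
proof -
  obtain q where q: "\<And>j. q j \<ge> 1" "\<And>j v. I j (q j * v) = I j (q j) [^]\<^bsub>ideals_set R\<^esub> v"
    using noetherian_filtration_veronese[OF assms] by metis
  \<comment> \<open>A multiple of every \<open>q j\<close>, hence a Veronese index for every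
    filtration.\<close>
  define Q where "Q = (\<Prod>j\<in>UNIV. q j)"
  have "Q \<ge> 1" unfolding Q_def by (intro prod_ge_1 q(1))
  moreover have "I j (Q * v) = I j Q [^]\<^bsub>ideals_set R\<^esub> v" for j v
  proof -
    have "q j dvd Q" by (simp add: Q_def dvd_prodI)
    then obtain k where "Q = q j * k" by (rule dvdE)
    then show ?thesis
      using veronese_multiple[OF graded_filtrationD(1)[OF assms(1)] q(2)] by simp
  qed
  ultimately show ?thesis unfolding common_veronese_index_def by blast
qed

text \<open>\<open>veronese_stable\<close> allows every \<open>a\<close> beyond a bound depending on
  \<open>j\<close>. One more than the sum of the finitely many bounds therefore serves all
  \<open>j\<close>, and is positive.\<close>

lemma stable_presentation_exists:
  fixes I :: "'s::finite \<Rightarrow> nat \<Rightarrow> 'a set"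
  assumes "\<And>j. graded_filtration R (I j)" "\<And>j. noetherian_filtration R (I j)"
    and "common_veronese_index R I q"
  shows "\<exists>a. stable_presentation R I q a"
proof -
  have "\<exists>B. \<forall>a\<ge>B. \<forall>m\<ge>a. \<forall>r<q.
      I j (q * m + r) = (I j q [^]\<^bsub>ideals_set R\<^esub> (m - a)) \<cdot> I j (q * a + r)" for j
    using assms by (intro veronese_stable) (auto simp: common_veronese_index_def)
  then obtain B where B: "\<And>j a m r. B j \<le> a \<Longrightarrow> a \<le> m \<Longrightarrow> r < q \<Longrightarrow>
      I j (q * m + r) = (I j q [^]\<^bsub>ideals_set R\<^esub> (m - a)) \<cdot> I j (q * a + r)"
    by metis
  have "B j \<le> Suc (\<Sum>j\<in>UNIV. B j)" for j
    using member_le_sum[of j UNIV B] by simp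
  with B have "stable_presentation R I q (Suc (\<Sum>j\<in>UNIV. B j))"
    unfolding stable_presentation_def by (metis le_add1 plus_1_eq_Suc)
  then show ?thesis ..
qed

end

section \<open>Limits along residue classes\<close>

text \<open>There are finitely many classes, so one threshold \<open>N\<close> serves them all.
  Every \<open>n\<close> from \<open>q * (N + a)\<close> on is reached with
  \<open>m = n div q - a\<close> and \<open>r = n mod q\<close>.\<close>

lemma tendsto_from_residue_classes:
  fixes f :: "nat \<Rightarrow> 'b::topological_space"
  assumes "q \<ge> 1" "\<And>r. r < q \<Longrightarrow> (\<lambda>m. f (q * (m + a) + r)) \<longlonglongrightarrow> l"
  shows "f \<longlonglongrightarrow> l"
proof (rule topological_tendstoI)
  fix S assume "open S" "l \<in> S"
  then have "\<forall>r\<in>{..<q}. \<forall>\<^sub>F m in sequentially. f (q * (m + a) + r) \<in> S"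
    using topological_tendstoD[OF assms(2)] by blast
  then have "\<forall>\<^sub>F m in sequentially. \<forall>r\<in>{..<q}. f (q * (m + a) + r) \<in> S"
    by (simp add: eventually_ball_finite_distrib)
  then obtain N where N: "\<And>m r. N \<le> m \<Longrightarrow> r < q \<Longrightarrow> f (q * (m + a) + r) \<in> S"
    unfolding eventually_sequentially by blast
  have "f n \<in> S" if "q * (N + a) \<le> n" for n
  proof -
    have "N + a \<le> n div q"
      using div_le_mono[OF that, of q] assms(1) by simp
    then have "f (q * ((n div q - a) + a) + n mod q) \<in> S"
      using assms(1) by (intro N) auto
    with \<open>N + a \<le> n div q\<close> show ?thesis by simp
  qed
  then show "\<forall>\<^sub>F n in sequentially. f n \<in> S" unfolding eventually_sequentially by blast
qed

text \<open>With \<open>n = q * (m + a) + r\<close>, the quotient \<open>f n / n^i\<close> equals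
  \<open>(error / m^i + c) * (m / n)^i\<close> for \<open>m \<ge> 1\<close>; the error term vanishes
  in the limit and \<open>m / n\<close> tends to \<open>1 / q\<close>, independently of
  \<open>r\<close>.\<close>

lemma quasi_polynomial_limit:
  fixes f :: "nat \<Rightarrow> real"
  assumes "q \<ge> 1" "i \<ge> 1"
    and O: "\<And>r. r < q \<Longrightarrow>
      (\<lambda>m. f (q * (m + a) + r) - real m ^ i * c) \<in> O(\<lambda>m. real m ^ (i - 1))"
  shows "(\<lambda>n. f n / real n ^ i) \<longlonglongrightarrow> c / real q ^ i"
proof (rule tendsto_from_residue_classes[OF assms(1)])
  fix r assume "r < q"
  let ?n = "\<lambda>m. q * (m + a) + r"
  \<comment> \<open>Here \<open>i \<ge> 1\<close> matters: for \<open>i = 0\<close> truncated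
    subtraction would make the two powers equal.\<close>
  have "(\<lambda>m::nat. real m ^ (i - 1)) \<in> o(\<lambda>m. real m ^ i)"
    using assms(2) by (intro smalloI_tendsto) (real_asymp, auto intro: eventually_sequentiallyI[of 1])
  with O[OF \<open>r < q\<close>] have "(\<lambda>m. f (?n m) - real m ^ i * c) \<in> o(\<lambda>m. real m ^ i)"
    by (rule landau_o.big_small_trans)
  then have "(\<lambda>m. (f (?n m) - real m ^ i * c) / real m ^ i) \<longlonglongrightarrow> 0"
    by (rule smalloD_tendsto)
  moreover have "(\<lambda>m. (real m / real (?n m)) ^ i) \<longlonglongrightarrow> inverse (real q) ^ i"
    using assms(1) by (intro tendsto_power) real_asymp
  ultimately have "(\<lambda>m. ((f (?n m) - real m ^ i * c) / real m ^ i + c) * (real m / real (?n m)) ^ i)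
      \<longlonglongrightarrow> (0 + c) * inverse (real q) ^ i"
    by (intro tendsto_mult tendsto_add tendsto_const)
  also have "(0 + c) * inverse (real q) ^ i = c / real q ^ i"
    by (simp add: divide_inverse power_inverse)
  finally show "(\<lambda>m. f (?n m) / real (?n m) ^ i) \<longlonglongrightarrow> c / real q ^ i"
    by (rule Lim_transform_eventually)
      (auto intro!: eventually_sequentiallyI[of 1] simp: power_divide field_simps)
qed

theorem proposition5p5:
  fixes R :: "('a, 'b) ring_scheme"
    and d :: nat
    and I :: "'s::finite \<Rightarrow> nat \<Rightarrow> 'a set"
  assumes "noetherian_local_ring R"
    and "krull_dim R = enat d" and "d \<ge> 1"
    and "\<And>j. graded_filtration R (I j)"
    and "\<And>j. noetherian_filtration R (I j)"
    and "\<And>j. ideal_height R (I j 1) > 0"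
  shows
    "(\<exists>q. common_veronese_index R I q) \<and>
     (\<forall>q. common_veronese_index R I q \<longrightarrow> (\<exists>a. stable_presentation R I q a)) \<and>
     (\<forall>q a. common_veronese_index R I q \<longrightarrow> stable_presentation R I q a \<longrightarrow>
        (\<forall>r i. \<forall>\<alpha> :: 's \<Rightarrow> nat. r < q \<longrightarrow> 1 \<le> i \<longrightarrow> i \<le> d \<longrightarrow> multi_degree \<alpha> = i - 1 \<longrightarrow>
           (\<lambda>m. diag_component R
                   (\<lambda>j. (I j q [^]\<^bsub>ideals_set R\<^esub> m) \<cdot>\<^bsub>R\<^esub> I j (q * a + r)) i \<alpha>
                 - real m ^ i * diag_component R (\<lambda>j. I j q) i \<alpha>)
             \<in> O(\<lambda>m. real m ^ (i - 1))) \<longrightarrow>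
        (\<forall>i. \<forall>\<alpha> :: 's \<Rightarrow> nat. 1 \<le> i \<longrightarrow> i \<le> d \<longrightarrow> multi_degree \<alpha> = i - 1 \<longrightarrow>
           convergent (\<lambda>n. diag_component R (\<lambda>j. I j n) i \<alpha> / real n ^ i) \<and>
           filtration_diag_component R I i \<alpha>
             = diag_component R (\<lambda>j. I j q) i \<alpha> / real q ^ i))"
proof -
  interpret noetherian_local_ring R by fact
  show ?thesis
  proof (intro conjI allI impI)
    show "\<exists>q. common_veronese_index R I q"
      using assms(4,5) by (rule common_veronese_index_exists)
    show "\<exists>a. stable_presentation R I q a" if "common_veronese_index R I q" for q
      using assms(4,5) that by (rule stable_presentation_exists)
    fix q a i and \<alpha> :: "'s \<Rightarrow> nat"
    assume q: "common_veronese_index R I q" and a: "stable_presentation R I q a"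
      and O: "\<forall>r i. \<forall>\<alpha> :: 's \<Rightarrow> nat. r < q \<longrightarrow> 1 \<le> i \<longrightarrow> i \<le> d \<longrightarrow> multi_degree \<alpha> = i - 1 \<longrightarrow>
           (\<lambda>m. diag_component R
                   (\<lambda>j. (I j q [^]\<^bsub>ideals_set R\<^esub> m) \<cdot>\<^bsub>R\<^esub> I j (q * a + r)) i \<alpha>
                 - real m ^ i * diag_component R (\<lambda>j. I j q) i \<alpha>)
             \<in> O(\<lambda>m. real m ^ (i - 1))"
      and i: "1 \<le> i" "i \<le> d" "multi_degree \<alpha> = i - 1"
    \<comment> \<open>Reading the stable presentation at \<open>m + a\<close> cancels the shift, so
      the ideals in the asymptotic assumption are exactly the members of the filtrations at index
      \<open>q * (m + a) + r\<close>.\<close>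
    have "I j (q * (m + a) + r) = (I j q [^]\<^bsub>ideals_set R\<^esub> (m + a - a)) \<cdot>\<^bsub>R\<^esub> I j (q * a + r)"
      if "r < q" for j m r
      using a that le_add2[of a m] unfolding stable_presentation_def by blast
    then have lim: "(\<lambda>n. diag_component R (\<lambda>j. I j n) i \<alpha> / real n ^ i)
        \<longlonglongrightarrow> diag_component R (\<lambda>j. I j q) i \<alpha> / real q ^ i"
      using O i q by (intro quasi_polynomial_limit[where a = a]) (auto simp: common_veronese_index_def)
    then show "convergent (\<lambda>n. diag_component R (\<lambda>j. I j n) i \<alpha> / real n ^ i)"
      by (rule convergentI)
    show "filtration_diag_component R I i \<alpha> = diag_component R (\<lambda>j. I j q) i \<alpha> / real q ^ i"
      unfolding filtration_diag_component_def using lim by (rule limI)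
  qed
qed

end
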